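(* Let $M$ be a matroid of rank $k$ on a ground set $E$ of size $n$, with $0<k<n$ and with no loops and no coloops. If $f_{i+1}^{\max}(M)-f_i^{\max}(M)\ge f_i^{\max}(M)-f_{i-1}^{\max}(M)$ for all $i=1,\dots,k-1$, then the sequence $\{d_i(M)\}_{i=1}^{n-k}$ is subadditive and cosubadditive.
   Context: $[m]=\{1,\dots,m\}$. For $0\le i\le k$, $f_i^{\max}(M)=\max\{|F| : F\subseteq E,\ \mathrm{rk}_M(F)=i\}$, the maximum cardinality of a flat of rank $i$. For $r\in[n-k]$ the $r$-th generalized Hamming weight of $M$ is $d_r(M)=\min\{|U| : U\subseteq E,\ |U|-\mathrm{rk}_M(U)=r\}$; this is a strictly increasing function of $r$ with values in $[n]$. A sequence $\{e_i\}_{i=1}^m$ is subadditive if $e_{i+j}\le e_i+e_j$ whenever $i,j,i+j\in[m]$. The Wei dual of $\{d_i(M)\}_{i=1}^{n-k}$ is the sequence whose $i$-th term ($1\le i\le k$) is the $i$-th element, in increasing order, of $[n]\setminus\{n+1-d_j(M) : j\in[n-k]\}$; it equals the sequence $\{d_i(M^* )\}_{i=1}^k$ of generalized Hamming weights of the dual matroid $M^*$. A sequence is cosubadditive if its Wei dual is subadditive. *)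

theory Defs
  imports Main
begin

locale matroid =
  fixes E :: "'a set" and indep :: "'a set \<Rightarrow> bool"
  assumes finite_ground: "finite E"
    and indep_ground: "indep X \<Longrightarrow> X \<subseteq> E"
    and indep_empty: "indep {}"
    and indep_subset: "indep X \<Longrightarrow> Y \<subseteq> X \<Longrightarrow> indep Y"
    and indep_augment:
      "indep X \<Longrightarrow> indep Y \<Longrightarrow> card X < card Y \<Longrightarrow> \<exists>y\<in>Y - X. indep (insert y X)"

definition rk :: "('a set \<Rightarrow> bool) \<Rightarrow> 'a set \<Rightarrow> nat" where
  "rk indep X = Max {card I | I. I \<subseteq> X \<and> indep I}"

definition basis :: "('a set \<Rightarrow> bool) \<Rightarrow> 'a set \<Rightarrow> bool" where
  "basis indep B \<longleftrightarrow> indep B \<and> (\<forall>X. indep X \<and> B \<subseteq> X \<longrightarrow> X = B)"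

definition loop :: "'a set \<Rightarrow> ('a set \<Rightarrow> bool) \<Rightarrow> 'a \<Rightarrow> bool" where
  "loop E indep e \<longleftrightarrow> e \<in> E \<and> \<not> indep {e}"

definition coloop :: "'a set \<Rightarrow> ('a set \<Rightarrow> bool) \<Rightarrow> 'a \<Rightarrow> bool" where
  "coloop E indep e \<longleftrightarrow> e \<in> E \<and> (\<forall>B. basis indep B \<longrightarrow> e \<in> B)"

text \<open>A rank-\<open>i\<close> set of maximum cardinality is a flat, so this is the maximum size of a
  rank-\<open>i\<close> flat. It is meaningful for \<open>i \<le> rk indep E\<close>.\<close>

definition f_max :: "'a set \<Rightarrow> ('a set \<Rightarrow> bool) \<Rightarrow> nat \<Rightarrow> nat" where
  "f_max E indep i = Max {card F | F. F \<subseteq> E \<and> rk indep F = i}"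

text \<open>The \<open>r\<close>-th generalized Hamming weight, meaningful for
  \<open>1 \<le> r \<le> card E - rk indep E\<close>. The subtraction never truncates in a matroid,
  since \<open>rk indep U \<le> card U\<close>.\<close>

definition gen_hamming_weight :: "'a set \<Rightarrow> ('a set \<Rightarrow> bool) \<Rightarrow> nat \<Rightarrow> nat" where
  "gen_hamming_weight E indep r = Min {card U | U. U \<subseteq> E \<and> card U - rk indep U = r}"

text \<open>A finite sequence \<open>e\<^sub>1, \<dots>, e\<^sub>m\<close> is given by its length \<open>m\<close> and a function
  \<open>e\<close> on \<open>nat\<close> of which only the values on \<open>{1..m}\<close> matter.\<close>

definition subadditive :: "nat \<Rightarrow> (nat \<Rightarrow> nat) \<Rightarrow> bool" where
  "subadditive m e \<longleftrightarrow>
     (\<forall>i\<in>{1..m}. \<forall>j\<in>{1..m}. i + j \<in> {1..m} \<longrightarrow> e (i + j) \<le> e i + e j)"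

text \<open>The Wei dual of a strictly increasing sequence \<open>e\<^sub>1, \<dots>, e\<^sub>m\<close> with values in
  \<open>{1..n}\<close>. It has length \<open>n - m\<close>, and its indices start at \<open>1\<close>, whereas list positions
  start at \<open>0\<close>.\<close>

definition wei_dual :: "nat \<Rightarrow> nat \<Rightarrow> (nat \<Rightarrow> nat) \<Rightarrow> nat \<Rightarrow> nat" where
  "wei_dual n m e i =
     sorted_list_of_set ({1..n} - {n + 1 - e j | j. j \<in> {1..m}}) ! (i - 1)"

definition cosubadditive :: "nat \<Rightarrow> nat \<Rightarrow> (nat \<Rightarrow> nat) \<Rightarrow> bool" where
  "cosubadditive n m e \<longleftrightarrow> subadditive (n - m) (wei_dual n m e)"

end

theory Submission
  imports Defs
begin

text \<open>Write \<open>f i\<close> for \<open>f_max E indep i\<close>. Extending a basis of a largest rank-\<open>i\<close> set by further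
  elements of that set shows that \<open>d\<^sub>r = r + i\<close> for the least \<open>i\<close> with \<open>r + i \<le> f i\<close>. Hence
  the weights are exactly the numbers in \<open>{1..n}\<close> not of the form \<open>f j + 1\<close> with \<open>j < k\<close>, and the
  Wei dual is \<open>i \<mapsto> n - f (k - i)\<close>. Both subadditivity statements are then instances of the
  inequality \<open>f (a + j) + f b \<le> f a + f (b + j)\<close> for \<open>a \<le> b\<close>, i.e. of the convexity of \<open>f\<close>.\<close>

context matroid
begin

section \<open>Elementary properties of the rank function\<close>

lemma finite_indep_cards: "finite {card I | I. I \<subseteq> X \<and> indep I}"
proof -
  have "{card I | I. I \<subseteq> X \<and> indep I} \<subseteq> card ` Pow E"
    using indep_ground by auto
  then show ?thesis
    using finite_ground by (meson finite_Pow_iff finite_imageI finite_subset)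
qed

lemma card_le_rk: "indep I \<Longrightarrow> I \<subseteq> X \<Longrightarrow> card I \<le> rk indep X"
  unfolding rk_def by (rule Max_ge[OF finite_indep_cards]) auto

lemma rk_attained: "\<exists>I. I \<subseteq> X \<and> indep I \<and> card I = rk indep X"
proof -
  have "rk indep X \<in> {card I | I. I \<subseteq> X \<and> indep I}"
    unfolding rk_def using indep_empty by (intro Max_in[OF finite_indep_cards]) auto
  then show ?thesis by auto
qed

lemma rk_mono: "X \<subseteq> Y \<Longrightarrow> rk indep X \<le> rk indep Y"
  using rk_attained[of X] card_le_rk[of _ Y] by (metis subset_trans)

lemma rk_le_card: "finite X \<Longrightarrow> rk indep X \<le> card X"
  using rk_attained[of X] by (metis card_mono)

lemma rk_insert_le: "rk indep (insert y X) \<le> Suc (rk indep X)"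
proof -
  obtain I where I: "I \<subseteq> insert y X" "indep I" "card I = rk indep (insert y X)"
    using rk_attained by blast
  have "card (I - {y}) \<le> rk indep X"
    using I by (intro card_le_rk indep_subset[OF I(2)]) auto
  then show ?thesis
    using I(3) card_Diff1_le[of I y] card_Diff_singleton_if[of I y] by (auto split: if_splits)
qed

section \<open>Growth of the largest size of a set of given rank\<close>

lemma finite_rk_level: "finite {card F | F. F \<subseteq> E \<and> rk indep F = i}"
proof -
  have "{card F | F. F \<subseteq> E \<and> rk indep F = i} \<subseteq> card ` Pow E" by auto
  then show ?thesis
    using finite_ground by (meson finite_Pow_iff finite_imageI finite_subset)
qed

lemma card_le_f_max: "F \<subseteq> E \<Longrightarrow> card F \<le> f_max E indep (rk indep F)"
  unfolding f_max_def by (rule Max_ge[OF finite_rk_level]) auto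

lemma f_max_attained:
  assumes "i \<le> rk indep E"
  shows "\<exists>F\<subseteq>E. rk indep F = i \<and> card F = f_max E indep i"
proof -
  \<comment> \<open>An \<open>i\<close>-element subset of a largest independent set has rank
    \<open>i\<close>, so the maximum is over a nonempty set.\<close>
  obtain B where B: "B \<subseteq> E" "indep B" "card B = rk indep E"
    using rk_attained by blast
  obtain I where I: "I \<subseteq> B" "card I = i"
    using assms B(3) by (metis obtain_subset_with_card_n)
  have "indep I" using B(2) I(1) by (rule indep_subset)
  then have "i \<le> rk indep I" using I(2) card_le_rk by blast
  moreover have "rk indep I \<le> i"
    using rk_le_card I B(1) finite_ground by (metis finite_subset)
  ultimately have "card I \<in> {card F | F. F \<subseteq> E \<and> rk indep F = i}"
    using I(1) B(1) by auto
  then have "f_max E indep i \<in> {card F | F. F \<subseteq> E \<and> rk indep F = i}"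
    unfolding f_max_def by (intro Max_in[OF finite_rk_level]) auto
  then show ?thesis by auto
qed

lemma f_max_0:
  assumes "\<not> (\<exists>e. loop E indep e)"
  shows "f_max E indep 0 = 0"
proof -
  obtain F where F: "F \<subseteq> E" "rk indep F = 0" "card F = f_max E indep 0"
    using f_max_attained[of 0] by auto
  have "F = {}"
  proof (rule ccontr)
    assume "F \<noteq> {}"
    then obtain e where "e \<in> F" by auto
    then have "indep {e}" using F(1) assms unfolding loop_def by auto
    then show False using card_le_rk[of "{e}" F] \<open>e \<in> F\<close> F(2) by auto
  qed
  then show ?thesis using F(3) by simp
qed

lemma f_max_rk: "f_max E indep (rk indep E) = card E"
proof (rule antisym)
  show "f_max E indep (rk indep E) \<le> card E"
    using f_max_attained[of "rk indep E"] finite_ground by (metis card_mono order_refl)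
qed (simp add: card_le_f_max)

text \<open>Augment a basis \<open>I\<close> of a largest rank-\<open>i\<close> set \<open>F\<close>
  by some \<open>y\<close> from a full-rank independent set. Adding \<open>y\<close> raises the rank
  of \<open>F\<close> by exactly one, so \<open>y\<close> is not in \<open>F\<close> and the size
  grows too.\<close>

lemma f_max_Suc:
  assumes "i < rk indep E"
  shows "Suc (f_max E indep i) \<le> f_max E indep (Suc i)"
proof -
  obtain F where F: "F \<subseteq> E" "rk indep F = i" "card F = f_max E indep i"
    using f_max_attained[of i] assms by auto
  obtain I where I: "I \<subseteq> F" "indep I" "card I = i"
    using rk_attained[of F] F(2) by auto
  obtain B where B: "B \<subseteq> E" "indep B" "card B = rk indep E"
    using rk_attained by blast
  obtain y where y: "y \<in> B - I" "indep (insert y I)"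
    using indep_augment[OF I(2) B(2)] I(3) B(3) assms by auto
  have "finite F" using F(1) finite_ground finite_subset by auto
  then have "finite I" using I(1) finite_subset by auto
  then have ge: "Suc i \<le> rk indep (insert y F)"
    using card_le_rk[OF y(2), of "insert y F"] I y(1) by auto
  then have rk: "rk indep (insert y F) = Suc i"
    using rk_insert_le[of y F] F(2) by simp
  have "y \<notin> F" using rk F(2) by (auto simp: insert_absorb)
  then show ?thesis
    using card_le_f_max[of "insert y F"] rk F y(1) B(1) \<open>finite F\<close> by auto
qed

text \<open>In other words, the largest nullity \<open>f i - i\<close> at rank \<open>i\<close> is
  nondecreasing in \<open>i\<close>. This form drives the later comparisons of weights.\<close>

lemma f_max_add_le:
  assumes "i + j \<le> rk indep E"
  shows "f_max E indep i + j \<le> f_max E indep (i + j)"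
  using assms
proof (induction j)
  case (Suc j)
  then show ?case using f_max_Suc[of "i + j"] by simp
qed simp

lemma f_max_mono:
  assumes "i \<le> j" "j \<le> rk indep E"
  shows "f_max E indep i \<le> f_max E indep j"
  using f_max_add_le[of i "j - i"] assms by simp

section \<open>Generalized Hamming weights in terms of rank and size\<close>

lemma finite_nullity_level: "finite {card U | U. U \<subseteq> E \<and> card U - rk indep U = r}"
proof -
  have "{card U | U. U \<subseteq> E \<and> card U - rk indep U = r} \<subseteq> card ` Pow E" by auto
  then show ?thesis
    using finite_ground by (meson finite_Pow_iff finite_imageI finite_subset)
qed

text \<open>Any set between a basis \<open>I\<close> of \<open>F\<close> and \<open>F\<close> itself
  has rank \<open>i\<close>, and every size from \<open>i\<close> to \<open>card F\<close> occurs
  among such sets.\<close>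

lemma ex_nullity_set:
  assumes "i \<le> rk indep E" "r + i \<le> f_max E indep i"
  shows "\<exists>U\<subseteq>E. card U = r + i \<and> rk indep U = i"
proof -
  obtain F where F: "F \<subseteq> E" "rk indep F = i" "card F = f_max E indep i"
    using f_max_attained assms(1) by blast
  obtain I where I: "I \<subseteq> F" "indep I" "card I = i"
    using rk_attained[of F] F(2) by auto
  have fin: "finite F" using F(1) finite_ground finite_subset by auto
  obtain U where U: "I \<subseteq> U" "U \<subseteq> F" "card U = r + i"
    using exists_subset_between[of I "r + i" F] I F(3) fin assms(2) by auto
  have "rk indep U = i"
    using card_le_rk[OF I(2) U(1)] rk_mono[OF U(2)] I(3) F(2) by simp
  then show ?thesis using U F(1) by blast
qed

lemma gen_hamming_weight_le:
  assumes "i \<le> rk indep E" "r + i \<le> f_max E indep i"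
  shows "gen_hamming_weight E indep r \<le> r + i"
proof -
  obtain U where "U \<subseteq> E" "card U = r + i" "rk indep U = i"
    using ex_nullity_set[OF assms] by blast
  then have "r + i \<in> {card U | U. U \<subseteq> E \<and> card U - rk indep U = r}"
    by (metis (mono_tags, lifting) add_diff_cancel_right' mem_Collect_eq)
  then show ?thesis
    unfolding gen_hamming_weight_def by (rule Min_le[OF finite_nullity_level])
qed

lemma gen_hamming_weight_attained:
  assumes "r \<le> card E - rk indep E"
  obtains i where "i \<le> rk indep E" "gen_hamming_weight E indep r = r + i"
    "r + i \<le> f_max E indep i"
proof -
  \<comment> \<open>A full-rank set \<open>V\<close> of nullity \<open>r\<close> shows that the
    minimum is attained; the index \<open>i\<close> is then the rank of a minimizing set
    \<open>U\<close>.\<close>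
  have "r + rk indep E \<le> f_max E indep (rk indep E)"
    using assms f_max_rk rk_le_card[OF finite_ground] by simp
  then obtain V where "V \<subseteq> E" "card V = r + rk indep E" "rk indep V = rk indep E"
    using ex_nullity_set by blast
  then have "{card U | U. U \<subseteq> E \<and> card U - rk indep U = r} \<noteq> {}"
    by (metis (mono_tags, lifting) add_diff_cancel_right' empty_Collect_eq)
  then have "gen_hamming_weight E indep r \<in> {card U | U. U \<subseteq> E \<and> card U - rk indep U = r}"
    unfolding gen_hamming_weight_def by (rule Min_in[OF finite_nullity_level])
  then obtain U where U: "U \<subseteq> E" "card U - rk indep U = r"
      "gen_hamming_weight E indep r = card U" by auto
  have "rk indep U \<le> card U"
    using rk_le_card U(1) finite_ground finite_subset by blast
  then show thesis
    using that[of "rk indep U"] U rk_mono[OF U(1)] card_le_f_max[OF U(1)] by simp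
qed

section \<open>The complement of the set of weights, and the Wei dual\<close>

lemma f_max_Suc_not_weight:
  assumes "j < rk indep E" "r \<le> card E - rk indep E"
  shows "gen_hamming_weight E indep r \<noteq> Suc (f_max E indep j)"
proof
  assume eq: "gen_hamming_weight E indep r = Suc (f_max E indep j)"
  obtain i where i: "i \<le> rk indep E" "gen_hamming_weight E indep r = r + i"
    "r + i \<le> f_max E indep i"
    using gen_hamming_weight_attained[OF assms(2)] by blast
  have "j < i"
    using f_max_mono[of i j] i eq assms(1) by (cases "j < i") auto
  \<comment> \<open>Here \<open>r + (i - 1) = f j\<close> with \<open>j \<le> i - 1\<close>, so
    already rank \<open>i - 1\<close> admits nullity \<open>r\<close>, against the minimality of the
    weight.\<close>
  then have "r + (i - 1) \<le> f_max E indep (i - 1)"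
    using f_max_mono[of j "i - 1"] i eq by linarith
  with i(1) have "gen_hamming_weight E indep r \<le> r + (i - 1)"
    by (intro gen_hamming_weight_le) auto
  then show False using i(2) \<open>j < i\<close> by linarith
qed

text \<open>If \<open>i\<close> is least with \<open>x \<le> f i\<close>, then
  \<open>f (i - 1) + 1 < x\<close>, since \<open>x\<close> is not \<open>f (i - 1) + 1\<close>. So
  nullity \<open>r = x - i\<close> is possible at rank \<open>i\<close> but not at rank
  \<open>i - 1\<close>, which makes \<open>x\<close> the \<open>r\<close>-th weight.\<close>

lemma weight_or_f_max_Suc:
  assumes x: "1 \<le> x" "x \<le> card E" and f0: "f_max E indep 0 = 0"
    and not: "\<And>j. j < rk indep E \<Longrightarrow> x \<noteq> Suc (f_max E indep j)"
  shows "\<exists>r\<in>{1..card E - rk indep E}. gen_hamming_weight E indep r = x"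
proof -
  define i where "i = (LEAST i. x \<le> f_max E indep i)"
  have top: "x \<le> f_max E indep (rk indep E)" using x f_max_rk by simp
  have xi: "x \<le> f_max E indep i" unfolding i_def using top by (rule LeastI)
  have ik: "i \<le> rk indep E" unfolding i_def using top by (rule Least_le)
  have "0 < i" using xi x(1) f0 by (cases i) auto
  have "f_max E indep (i - 1) < x"
    using not_less_Least[of "i - 1" "\<lambda>i. x \<le> f_max E indep i"] \<open>0 < i\<close>
    unfolding i_def[symmetric] by simp
  moreover have "x \<noteq> Suc (f_max E indep (i - 1))"
    using not[of "i - 1"] \<open>0 < i\<close> ik by simp
  ultimately have gap: "Suc (f_max E indep (i - 1)) < x" by simp
  have "i - 1 \<le> f_max E indep (i - 1)"
    using f_max_add_le[of 0 "i - 1"] f0 ik by simp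
  then have ix: "i < x" using gap \<open>0 < i\<close> by simp
  define r where "r = x - i"
  have xr: "x = r + i" using ix r_def by simp
  \<comment> \<open>Bounds the nullity: \<open>r \<le> f i - i \<le> n - k\<close>.\<close>
  have "f_max E indep i + (rk indep E - i) \<le> card E"
    using f_max_add_le[of i "rk indep E - i"] ik f_max_rk by simp
  then have r: "r \<in> {1..card E - rk indep E}" using xr xi ix ik by simp
  obtain i' where i': "i' \<le> rk indep E" "gen_hamming_weight E indep r = r + i'"
    "r + i' \<le> f_max E indep i'"
    using gen_hamming_weight_attained[of r] r by auto
  \<comment> \<open>Monotonicity of \<open>f i - i\<close> carries the failure at rank
    \<open>i - 1\<close> down to every smaller rank.\<close>
  have "i \<le> i'"
  proof (rule ccontr)
    assume "\<not> i \<le> i'"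
    then have "f_max E indep i' + (i - 1 - i') \<le> f_max E indep (i - 1)"
      using f_max_add_le[of i' "i - 1 - i'"] ik by simp
    then show False using i'(3) gap xr \<open>\<not> i \<le> i'\<close> by linarith
  qed
  then have "gen_hamming_weight E indep r = x"
    using gen_hamming_weight_le[OF ik, of r] xi i'(2) xr by simp
  then show ?thesis using r by blast
qed

lemma wei_dual_gen_hamming_weight:
  assumes f0: "f_max E indep 0 = 0" and i: "i \<in> {1..rk indep E}"
  shows "wei_dual (card E) (card E - rk indep E) (gen_hamming_weight E indep) i
    = card E - f_max E indep (rk indep E - i)"
proof -
  let ?n = "card E" and ?k = "rk indep E" and ?f = "f_max E indep"
    and ?d = "gen_hamming_weight E indep"
  let ?S = "{1..?n} - {?n + 1 - ?d j | j. j \<in> {1..?n - ?k}}"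
  \<comment> \<open>The values \<open>n - f j\<close> for \<open>j\<close> descending from
    \<open>k - 1\<close> to \<open>0\<close>; \<open>Suc\<close> accounts for list positions
    starting at 0.\<close>
  let ?xs = "map (\<lambda>i. ?n - ?f (?k - Suc i)) [0..<?k]"
  have lt: "?f j < ?n" if "j < ?k" for j
    using f_max_add_le[of j "?k - j"] f_max_rk that by simp
  have d_le: "?d r \<le> ?n" if "r \<le> ?n - ?k" for r
    using gen_hamming_weight_attained[OF that] f_max_mono f_max_rk
    by (metis order_refl order_trans)
  have S: "set ?xs = ?S"
  proof (intro subset_antisym subsetI)
    fix y assume "y \<in> set ?xs"
    then obtain m where m: "m < ?k" "y = ?n - ?f (?k - Suc m)" by auto
    define j where "j = ?k - Suc m"
    have j: "j < ?k" "y = ?n - ?f j" using m j_def by auto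
    have "y \<noteq> ?n + 1 - ?d r" if "r \<in> {1..?n - ?k}" for r
      using that f_max_Suc_not_weight[OF j(1), of r] d_le[of r] lt[OF j(1)] j(2) by auto
    then show "y \<in> ?S" using j(2) lt[OF j(1)] by auto
  next
    fix y assume y: "y \<in> ?S"
    \<comment> \<open>The reflection \<open>y \<mapsto> n + 1 - y\<close> turns the complement of
      the reflected weights into the non-weights \<open>f j + 1\<close>, hence
      \<open>y = n - f j\<close>.\<close>
    define x where "x = ?n + 1 - y"
    have x: "1 \<le> x" "x \<le> ?n" "y = ?n + 1 - x" using y x_def by auto
    have "\<not> (\<exists>r\<in>{1..?n - ?k}. ?d r = x)" using y x(3) by auto
    then obtain j where j: "j < ?k" "x = Suc (?f j)"
      using weight_or_f_max_Suc[OF x(1,2) f0] by blast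
    have "y = ?n - ?f (?k - Suc (?k - Suc j))" using x(3) j by simp
    moreover have "?k - Suc j \<in> set [0..<?k]" using j(1) by simp
    ultimately show "y \<in> set ?xs" unfolding set_map by (rule image_eqI)
  qed
  have "sorted_wrt (<) ?xs"
  proof (unfold sorted_wrt_iff_nth_less, intro allI impI)
    fix a b assume ab: "a < b" "b < length ?xs"
    have "?f (?k - Suc b) < ?f (?k - Suc a)"
      using f_max_add_le[of "?k - Suc b" "b - a"] ab by simp
    then show "?xs ! a < ?xs ! b"
      using ab lt[of "?k - Suc a"] by (simp add: diff_less_mono2)
  qed
  then have "sorted_list_of_set ?S = ?xs"
    unfolding S[symmetric] by (intro sorted_list_of_set.idem_if_sorted_distinct)
      (auto simp: strict_sorted_iff)
  then have "wei_dual ?n (?n - ?k) ?d i = ?xs ! (i - 1)"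
    unfolding wei_dual_def by (rule arg_cong)
  also have "\<dots> = ?n - ?f (?k - i)" using i by (subst nth_map) auto
  finally show ?thesis .
qed

end

section \<open>Convexity and the two subadditivity statements\<close>

lemma convex_increment:
  fixes f :: "nat \<Rightarrow> nat"
  assumes conv: "\<And>i. 1 \<le> i \<Longrightarrow> i < k \<Longrightarrow> 2 * f i \<le> f (i - 1) + f (i + 1)"
    and "a \<le> b" "b + j \<le> k"
  shows "f (a + j) + f b \<le> f a + f (b + j)"
proof -
  \<comment> \<open>The case \<open>j = 1\<close>: increments are nondecreasing. The outer induction
    adds up \<open>j\<close> of these.\<close>
  have step: "f (Suc a) + f b \<le> f a + f (Suc b)" if "a \<le> b" "b < k" for a b
    using that
  proof (induction b rule: dec_induct)
    case (step b)
    then show ?case using conv[of "Suc b"] by simp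
  qed simp
  show ?thesis
    using assms(3)
  proof (induction j)
    case (Suc j)
    then show ?case using step[of "a + j" "b + j"] \<open>a \<le> b\<close> by simp
  qed simp
qed

theorem proposition4p19:
  fixes E :: "'a set" and indep :: "'a set \<Rightarrow> bool" and n k :: nat
  assumes "matroid E indep"
    and "card E = n"
    and "rk indep E = k"
    and "0 < k" and "k < n"
    and "\<not> (\<exists>e. loop E indep e)"
    and "\<not> (\<exists>e. coloop E indep e)"
    and "\<forall>i\<in>{1..k - 1}.
           int (f_max E indep (i + 1)) - int (f_max E indep i)
             \<ge> int (f_max E indep i) - int (f_max E indep (i - 1))"
  shows "subadditive (n - k) (gen_hamming_weight E indep)
       \<and> cosubadditive n (n - k) (gen_hamming_weight E indep)"
proof -
  interpret matroid E indep by (rule assms(1))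
  let ?f = "f_max E indep" and ?d = "gen_hamming_weight E indep"
  have k: "rk indep E = k" and n: "card E = n" by (fact assms)+
  have f0: "?f 0 = 0" using f_max_0 assms(6) .
  have fk: "?f k = n" using f_max_rk k n by simp
  have "2 * ?f i \<le> ?f (i - 1) + ?f (i + 1)" if "1 \<le> i" "i < k" for i
  proof -
    have "i \<in> {1..k - 1}" using that by auto
    from bspec[OF assms(8) this] show ?thesis by linarith
  qed
  note incr = convex_increment[of k ?f, OF this]
  have "?d (r + s) \<le> ?d r + ?d s" if "r + s \<le> n - k" for r s
  proof -
    have rs: "r \<le> card E - rk indep E" "s \<le> card E - rk indep E"
      using that k n by simp_all
    obtain a where a: "a \<le> k" "?d r = r + a" "r + a \<le> ?f a"
      using gen_hamming_weight_attained[OF rs(1), unfolded k] by blast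
    obtain b where b: "b \<le> k" "?d s = s + b" "s + b \<le> ?f b"
      using gen_hamming_weight_attained[OF rs(2), unfolded k] by blast
    show ?thesis
    proof (cases "a + b \<le> k")
      case True
      \<comment> \<open>With \<open>f 0 = 0\<close>, convexity yields superadditivity, so rank
        \<open>a + b\<close> admits nullity \<open>r + s\<close>.\<close>
      then have "?f a + ?f b \<le> ?f (a + b)"
        using incr[of 0 b a] f0 by (simp add: add.commute)
      then show ?thesis
        using gen_hamming_weight_le[of "a + b" "r + s"] True a b k by simp
    next
      case False
      \<comment> \<open>When \<open>a + b\<close> exceeds \<open>k\<close>, full rank already admits
        nullity \<open>r + s\<close>, at lower cost.\<close>
      have "r + s + k \<le> ?f k" using that fk assms(5) by linarith
      then have "?d (r + s) \<le> r + s + k" using gen_hamming_weight_le k by simp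
      then show ?thesis using False a(2) b(2) by linarith
    qed
  qed
  then have sub: "subadditive (n - k) ?d" unfolding subadditive_def by simp
  have dual: "wei_dual n (n - k) ?d i = n - ?f (k - i)" if "i \<in> {1..k}" for i
    using wei_dual_gen_hamming_weight[OF f0] that k n by simp
  \<comment> \<open>Compares the \<open>j\<close> steps up from \<open>k - (i + j)\<close> with the
    last \<open>j\<close> steps, which end at \<open>f k = n\<close>.\<close>
  have "n - ?f (k - (i + j)) \<le> (n - ?f (k - i)) + (n - ?f (k - j))" if "i + j \<le> k" for i j
  proof -
    have "k - (i + j) \<le> k - j" "k - j + j \<le> k" "k - (i + j) + j = k - i" "k - j + j = k"
      using that by linarith+
    then show ?thesis
      using incr[of "k - (i + j)" "k - j" j] fk by simp linarith
  qed
  then have "subadditive k (wei_dual n (n - k) ?d)"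
    unfolding subadditive_def using dual by simp
  then show ?thesis
    using sub assms(5) unfolding cosubadditive_def by simp
qed

end
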